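(* Let $R$ be an integral domain with unity, let $\mathbb{F}$ be a field with $\mathrm{char}(\mathbb{F})=0$ containing $R$ as a subring, let $n\in\mathbb{N}$, and let $A\colon R\to R\subset\mathbb{F}$ be an additive mapping satisfying $A(1)=0$. Then $A\in\mathscr{D}_{n}(R)$ if and only if there exist constants $a_{1},\ldots,a_{n+1}\in\mathbb{F}$, not all zero, such that $$\sum_{i=0}^{n}\frac{a_{n+1-i}}{\binom{n+1}{i}}\sum_{\mathrm{card}(I)=i}\left(\prod_{j\in I}x_{j}\right)\cdot A\left(\prod_{k\in\{1,\ldots,n+1\}\setminus I}x_{k}\right)=0$$ for all $x_{1},\ldots,x_{n+1}\in R$. Moreover, if $A$ is a not identically zero solution of this equation (with constants $a_1,\ldots,a_{n+1}$), then $\sum_{i=1}^{n+1}i\,a_{i}=0$.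
   Context: $\mathbb{N}$ denotes the nonnegative integers. A mapping $f\colon R\to R$ on a ring is additive if $f(x+y)=f(x)+f(y)$ for all $x,y\in R$. Higher order derivations: let $R$ be a ring. The identically zero map is the only derivation of order zero. For each integer $n\ge 1$, an additive mapping $f\colon R\to R$ is a derivation of order $n$ if there exists $B\colon R\times R\to R$ such that $B$ is a bi-derivation of order $n-1$ (that is, $B$ is a derivation of order $n-1$ in each variable, the other variable being fixed) and $f(xy)-xf(y)-f(x)y=B(x,y)$ for all $x,y\in R$. The set of derivations of order $n$ of $R$ is denoted by $\mathscr{D}_{n}(R)$. The inner sum runs over all subsets $I\subset\{1,\ldots,n+1\}$ of cardinality $i$; an empty product equals $1$. The equation is understood in $\mathbb{F}$. *)

theory Defs
  imports Main "HOL-Library.FuncSet"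
begin

text \<open>
  The field is a type of class \<open>field_char_0\<close> and the ring $R$ is a subset of it.
  Such a subset is automatically commutative and free of zero divisors, so no separate
  integral domain assumption is needed; and the unity of a subring of a field that is
  itself an integral domain is necessarily the unity of the field.
  Maps on $R$ are functions on the ambient type, of which only the values on $R$ matter.
\<close>

definition unital_subring :: "'a::ring_1 set \<Rightarrow> bool" where
  "unital_subring R \<longleftrightarrow>
     1 \<in> R \<and> (\<forall>x\<in>R. \<forall>y\<in>R. x - y \<in> R) \<and> (\<forall>x\<in>R. \<forall>y\<in>R. x * y \<in> R)"

definition additive_on :: "'a::ring set \<Rightarrow> ('a \<Rightarrow> 'a) \<Rightarrow> bool" where
  "additive_on R f \<longleftrightarrow> f \<in> R \<rightarrow> R \<and> (\<forall>x\<in>R. \<forall>y\<in>R. f (x + y) = f x + f y)"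

primrec derivations_of_order :: "nat \<Rightarrow> 'a::ring set \<Rightarrow> ('a \<Rightarrow> 'a) set" where
  "derivations_of_order 0 R = {f. \<forall>x\<in>R. f x = 0}"
| "derivations_of_order (Suc n) R =
     {f. additive_on R f \<and>
         (\<exists>B. (\<forall>x\<in>R. \<forall>y\<in>R. B x y \<in> R) \<and>
              (\<forall>y\<in>R. (\<lambda>x. B x y) \<in> derivations_of_order n R) \<and>
              (\<forall>x\<in>R. (\<lambda>y. B x y) \<in> derivations_of_order n R) \<and>
              (\<forall>x\<in>R. \<forall>y\<in>R. f (x * y) - x * f y - f x * y = B x y))}"

text \<open>
  Only the values of \<open>a\<close> and \<open>x\<close> at the indices \<open>1, \<dots>, n + 1\<close> are used.
\<close>

definition symmetrized_sum ::
    "nat \<Rightarrow> (nat \<Rightarrow> 'a::field_char_0) \<Rightarrow> ('a \<Rightarrow> 'a) \<Rightarrow> (nat \<Rightarrow> 'a) \<Rightarrow> 'a" where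
  "symmetrized_sum n a A x =
     (\<Sum>i=0..n. a (n + 1 - i) / of_nat ((n + 1) choose i) *
        (\<Sum>I | I \<subseteq> {1..n + 1} \<and> card I = i.
           (\<Prod>j\<in>I. x j) * A (\<Prod>k\<in>{1..n + 1} - I. x k)))"

end

theory Submission imports Defs begin

text \<open>
  For an additive \<open>A\<close> with \<open>A 1 = 0\<close>, being a derivation of order \<open>n\<close> means that the symmetric form
  in \<open>n + 1\<close> variables with the coefficients \<open>(- 1) ^ card I\<close> vanishes. Putting one variable
  equal to \<open>1\<close> turns a vanishing form with coefficients \<open>c\<^sub>i\<close> into a vanishing form in one variable
  less, with coefficients \<open>c\<^sub>i + c\<^sub>i\<^sub>+\<^sub>1\<close>. Either these are not all zero, and \<open>A\<close> is by induction
  a derivation of order \<open>n - 1\<close>, or \<open>c\<^sub>i = (- 1)\<^sup>i c\<^sub>0\<close> and the form is a multiple of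
  the alternating one. Putting all variables but one equal to \<open>1\<close> leaves
  \<open>(\<Sum>i. (n choose i) * c\<^sub>i) * A x = 0\<close>, which is the linear relation between the constants.
\<close>

section \<open>Weighted symmetric forms: adding a variable, and setting it to 1\<close>

definition symmetric_form ::
    "(nat \<Rightarrow> 'a::comm_ring_1) \<Rightarrow> ('a \<Rightarrow> 'a) \<Rightarrow> 'b set \<Rightarrow> ('b \<Rightarrow> 'a) \<Rightarrow> 'a" where
  "symmetric_form c A S x = (\<Sum>I\<in>Pow S. c (card I) * ((\<Prod>j\<in>I. x j) * A (\<Prod>k\<in>S - I. x k)))"

abbreviation alternating_form :: "('a::comm_ring_1 \<Rightarrow> 'a) \<Rightarrow> 'b set \<Rightarrow> ('b \<Rightarrow> 'a) \<Rightarrow> 'a" where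
  "alternating_form \<equiv> symmetric_form (\<lambda>i. (- 1) ^ i)"

lemma sum_Pow_insert:
  assumes "finite S" "t \<notin> S"
  shows "(\<Sum>I\<in>Pow (insert t S). g I) = (\<Sum>I\<in>Pow S. g I + g (insert t I))"
proof -
  have "inj_on (insert t) (Pow S)"
    using assms by (auto simp: inj_on_def)
  moreover have "Pow S \<inter> insert t ` Pow S = {}"
    using assms by auto
  ultimately show ?thesis
    using assms by (simp add: Pow_insert sum.union_disjoint sum.reindex sum.distrib)
qed

text \<open>Split the subsets by membership of \<open>t\<close>. Without \<open>t\<close>, the
  factor \<open>x t\<close> sits inside \<open>A\<close>; with \<open>t\<close>, it comes out in
  front, and the larger cardinality shifts the coefficients by one.\<close>

lemma symmetric_form_insert:
  assumes "finite S" "t \<notin> S"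
  shows "symmetric_form c A (insert t S) x =
    symmetric_form c (\<lambda>u. A (x t * u)) S x + x t * symmetric_form (\<lambda>i. c (Suc i)) A S x"
proof -
  have "c (card I) * (prod x I * A (prod x (insert t S - I))) +
      c (card (insert t I)) * (prod x (insert t I) * A (prod x (insert t S - insert t I))) =
      c (card I) * (prod x I * A (x t * prod x (S - I))) +
      x t * (c (Suc (card I)) * (prod x I * A (prod x (S - I))))" if "I \<in> Pow S" for I
  proof -
    have "finite I" "t \<notin> I"
      using that assms by (auto intro: finite_subset)
    moreover have "insert t S - I = insert t (S - I)" "insert t S - insert t I = S - I"
      using that assms by auto
    ultimately show ?thesis
      using assms by (simp add: algebra_simps)
  qed
  then show ?thesis
    unfolding symmetric_form_def sum_Pow_insert[OF assms]
    by (simp add: sum.distrib sum_distrib_left)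
qed

lemma symmetric_form_add:
  "symmetric_form c A S x + symmetric_form d A S x = symmetric_form (\<lambda>i. c i + d i) A S x"
  by (simp add: symmetric_form_def sum.distrib[symmetric] algebra_simps)

lemma symmetric_form_mult:
  "symmetric_form (\<lambda>i. b * c i) A S x = b * symmetric_form c A S x"
  by (simp add: symmetric_form_def sum_distrib_left algebra_simps)

lemma alternating_form_insert:
  assumes "finite S" "t \<notin> S"
  shows "alternating_form A (insert t S) x =
    alternating_form (\<lambda>u. A (x t * u)) S x - x t * alternating_form A S x"
  using symmetric_form_mult[of "- 1" "\<lambda>i. (- 1) ^ i" A S x]
  by (simp add: symmetric_form_insert[OF assms])

text \<open>The coefficient at \<open>card S\<close> belongs to the term \<open>I = S\<close> alone,
  which carries the empty product and hence \<open>A 1 = 0\<close>. So the top coefficient is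
  free.\<close>

lemma symmetric_form_cong:
  assumes "A 1 = 0" "finite S" "\<And>i. i < card S \<Longrightarrow> c i = d i"
  shows "symmetric_form c A S x = symmetric_form d A S x"
  unfolding symmetric_form_def
proof (rule sum.cong[OF refl])
  fix I assume "I \<in> Pow S"
  then have "I = S \<or> card I < card S"
    using assms(2) by (auto intro: psubset_card_mono)
  then show "c (card I) * (prod x I * A (prod x (S - I))) =
      d (card I) * (prod x I * A (prod x (S - I)))"
    using assms by auto
qed

lemma symmetric_form_cong_var:
  assumes "\<And>j. j \<in> S \<Longrightarrow> x j = y j"
  shows "symmetric_form c A S x = symmetric_form c A S y"
  unfolding symmetric_form_def
proof (rule sum.cong[OF refl])
  fix I assume "I \<in> Pow S"
  then have "prod x I = prod y I" "prod x (S - I) = prod y (S - I)"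
    using assms by (auto intro!: prod.cong)
  then show "c (card I) * (prod x I * A (prod x (S - I))) =
      c (card I) * (prod y I * A (prod y (S - I)))" by simp
qed

text \<open>At \<open>x t = 1\<close> both halves of the splitting are forms of the same
  \<open>A\<close> on \<open>S\<close>, so consecutive coefficients add up.\<close>

lemma symmetric_form_insert_one:
  assumes "finite S" "t \<notin> S"
  shows "symmetric_form c A (insert t S) (x(t := 1)) =
    symmetric_form (\<lambda>i. c i + c (Suc i)) A S x"
proof -
  have "symmetric_form d A S (x(t := 1)) = symmetric_form d A S x" for d
    using assms by (intro symmetric_form_cong_var) auto
  then show ?thesis
    by (simp add: symmetric_form_insert[OF assms] symmetric_form_add)
qed

lemma symmetric_form_singleton:
  assumes "A 1 = 0"
  shows "symmetric_form c A {t} x = c 0 * A (x t)"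
  using assms by (simp add: symmetric_form_def Pow_insert)

lemma sum_alternating_Pow:
  assumes "finite S" "S \<noteq> {}"
  shows "(\<Sum>I\<in>Pow S. (- 1) ^ card I) = (0 :: 'a::comm_ring_1)"
proof -
  obtain t T where S: "S = insert t T" "t \<notin> T" "finite T"
    using assms by (metis ex_in_conv finite_insert mk_disjoint_insert)
  have "(- 1 :: 'a) ^ card I + (- 1) ^ card (insert t I) = 0" if "I \<in> Pow T" for I
  proof -
    have "finite I" "t \<notin> I"
      using that S by (auto intro: finite_subset)
    then show ?thesis by simp
  qed
  then show ?thesis
    by (simp add: S sum_Pow_insert)
qed

lemma atLeastAtMost_Suc_insert: "{1..Suc n + 1} = insert (Suc (Suc n)) {1..n + 1}"
  by auto

section \<open>Subring closure, additive maps and Leibniz defects\<close>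

lemma unital_subring_zero: "unital_subring R \<Longrightarrow> 0 \<in> R"
  unfolding unital_subring_def by (metis diff_self)

lemma unital_subring_add:
  assumes "unital_subring R" "x \<in> R" "y \<in> R"
  shows "x + y \<in> R"
proof -
  have "x - (0 - y) \<in> R"
    using assms unital_subring_zero[OF assms(1)] unfolding unital_subring_def by blast
  then show ?thesis by simp
qed

lemma additive_on_cong:
  assumes "unital_subring R" "\<And>u. u \<in> R \<Longrightarrow> f u = g u" "additive_on R f"
  shows "additive_on R g"
proof -
  have "u + v \<in> R" if "u \<in> R" "v \<in> R" for u v
    using unital_subring_add[OF assms(1) that] .
  then show ?thesis
    using assms unfolding additive_on_def by (auto simp: Pi_iff)
qed

lemma unital_subring_prod:
  assumes "unital_subring R" "\<And>j. j \<in> S \<Longrightarrow> x j \<in> R"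
  shows "prod x S \<in> R"
  using assms(2)
  by (induction S rule: infinite_finite_induct) (use assms(1) in \<open>auto simp: unital_subring_def\<close>)

lemma symmetric_form_cong_fun:
  assumes "unital_subring R" "\<And>j. j \<in> S \<Longrightarrow> x j \<in> R" "\<And>u. u \<in> R \<Longrightarrow> f u = g u"
  shows "symmetric_form c f S x = symmetric_form c g S x"
  unfolding symmetric_form_def
proof (rule sum.cong[OF refl])
  fix I
  have "prod x (S - I) \<in> R"
    using assms(2) by (intro unital_subring_prod[OF assms(1)]) auto
  then show "c (card I) * (prod x I * f (prod x (S - I))) =
      c (card I) * (prod x I * g (prod x (S - I)))"
    using assms(3) by simp
qed

text \<open>On \<open>R\<close> this is the only candidate for the \<open>B\<close> in the
  definition of a derivation of positive order.\<close>

definition leibniz_defect :: "('a::comm_ring_1 \<Rightarrow> 'a) \<Rightarrow> 'a \<Rightarrow> 'a \<Rightarrow> 'a" where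
  "leibniz_defect f x y = f (x * y) - x * f y - f x * y"

lemma leibniz_defect_commute: "leibniz_defect f x y = leibniz_defect f y x"
  by (simp add: leibniz_defect_def mult.commute)

lemma leibniz_defect_one: "f 1 = 0 \<Longrightarrow> leibniz_defect f 1 y = 0"
  by (simp add: leibniz_defect_def)

lemma leibniz_defect_in:
  assumes "unital_subring R" "additive_on R f" "x \<in> R" "y \<in> R"
  shows "leibniz_defect f x y \<in> R"
  using assms unfolding leibniz_defect_def unital_subring_def additive_on_def by (auto simp: Pi_iff)

lemma additive_on_leibniz_defect:
  assumes "unital_subring R" "additive_on R f" "y \<in> R"
  shows "additive_on R (\<lambda>x. leibniz_defect f x y)"
proof -
  have "leibniz_defect f (u + v) y = leibniz_defect f u y + leibniz_defect f v y"
    if "u \<in> R" "v \<in> R" for u v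
  proof -
    have "u * y \<in> R" "v * y \<in> R"
      using assms that unfolding unital_subring_def by auto
    then show ?thesis
      using assms that unfolding leibniz_defect_def additive_on_def by (simp add: algebra_simps)
  qed
  then show ?thesis
    using leibniz_defect_in[OF assms(1,2)] assms(3) by (auto simp: additive_on_def)
qed

section \<open>Higher order derivations as zeros of the alternating form\<close>

lemma alternating_form_leibniz_defect:
  fixes A :: "'a::comm_ring_1 \<Rightarrow> 'a"
  assumes "finite S" "S \<noteq> {}" "t \<notin> S"
  shows "alternating_form (\<lambda>u. leibniz_defect A u (x t)) S x = alternating_form A (insert t S) x"
proof -
  let ?s = "\<lambda>I. (- 1) ^ card I :: 'a"
  have split: "prod x S = prod x I * prod x (S - I)" if "I \<in> Pow S" for I
    using that assms(1) by (metis PowD mult.commute prod.subset_diff)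
  \<comment> \<open>The defect has three terms. In the middle one the product over
    \<open>S - I\<close> leaves \<open>A\<close> and completes the product over \<open>I\<close> to
    \<open>prod x S\<close>, so only a sum of signs depends on \<open>I\<close>; it vanishes because
    \<open>S\<close> is nonempty. The other two are the insertion formula.\<close>
  have "alternating_form (\<lambda>u. leibniz_defect A u (x t)) S x =
      (\<Sum>I\<in>Pow S. ?s I * (prod x I * A (x t * prod x (S - I))) -
        ?s I * (prod x S * A (x t)) - x t * (?s I * (prod x I * A (prod x (S - I)))))"
    unfolding symmetric_form_def
    by (rule sum.cong[OF refl]) (simp add: leibniz_defect_def split algebra_simps)
  also have "\<dots> = alternating_form (\<lambda>u. A (x t * u)) S x -
      (\<Sum>I\<in>Pow S. ?s I) * (prod x S * A (x t)) - x t * alternating_form A S x"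
    unfolding symmetric_form_def sum_subtractf sum_distrib_left sum_distrib_right ..
  finally show ?thesis
    using assms by (simp add: sum_alternating_Pow alternating_form_insert)
qed

text \<open>Induction on the order: fixing one argument of the Leibniz defect lowers the order by
  one and removes one variable from the form. Additivity on \<open>R\<close> and vanishing at 1 are
  inherited by the defect.\<close>

lemma derivations_of_order_iff_alternating_form:
  fixes R :: "'a::comm_ring_1 set"
  assumes "unital_subring R" "additive_on R A" "A 1 = 0"
  shows "A \<in> derivations_of_order n R \<longleftrightarrow>
    (\<forall>x. (\<forall>j\<in>{1..n + 1}. x j \<in> R) \<longrightarrow> alternating_form A {1..n + 1} x = 0)"
  using assms(2,3)
proof (induction n arbitrary: A)
  case 0
  then show ?case
    by (auto simp: symmetric_form_singleton)
next
  case (Suc n)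
  note R = assms(1)
  have form: "alternating_form (\<lambda>u. leibniz_defect A u (x (Suc (Suc n)))) {1..n + 1} x =
      alternating_form A {1..Suc n + 1} x" for x
    using alternating_form_leibniz_defect[of "{1..n + 1}" "Suc (Suc n)" A x]
    unfolding atLeastAtMost_Suc_insert by simp
  show ?case
  proof safe
    fix x assume x: "\<forall>j\<in>{1..Suc n + 1}. x j \<in> R"
    let ?y = "x (Suc (Suc n))"
    have y: "?y \<in> R" using x by simp
    assume "A \<in> derivations_of_order (Suc n) R"
    then obtain B where B: "(\<lambda>u. B u ?y) \<in> derivations_of_order n R"
      and eq: "\<And>u. u \<in> R \<Longrightarrow> leibniz_defect A u ?y = B u ?y"
      using y by (auto simp: leibniz_defect_def)
    \<comment> \<open>\<open>B\<close> agrees with the defect only on \<open>R\<close>, so the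
      hypotheses of the induction are carried over to \<open>B\<close>, and the vanishing of its
      form is carried back.\<close>
    have "1 \<in> R" using R by (simp add: unital_subring_def)
    then have "B 1 ?y = 0"
      using eq leibniz_defect_one[where f = A, OF Suc.prems(2)] by metis
    moreover have "additive_on R (\<lambda>u. B u ?y)"
      using additive_on_cong[OF R eq additive_on_leibniz_defect[OF R Suc.prems(1) y]] .
    ultimately have "alternating_form (\<lambda>u. B u ?y) {1..n + 1} x = 0"
      using Suc.IH[of "\<lambda>u. B u ?y"] B x by simp
    then show "alternating_form A {1..Suc n + 1} x = 0"
      using x eq symmetric_form_cong_fun[OF R, of "{1..n + 1}" x "\<lambda>u. B u ?y"
        "\<lambda>u. leibniz_defect A u ?y"] form[of x] by simp
  next
    assume zero: "\<forall>x. (\<forall>j\<in>{1..Suc n + 1}. x j \<in> R) \<longrightarrow> alternating_form A {1..Suc n + 1} x = 0"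
    have left: "(\<lambda>u. leibniz_defect A u y) \<in> derivations_of_order n R" if y: "y \<in> R" for y
    proof -
      have "alternating_form (\<lambda>u. leibniz_defect A u y) {1..n + 1} x = 0"
        if x: "\<forall>j\<in>{1..n + 1}. x j \<in> R" for x
      proof -
        \<comment> \<open>The fixed argument \<open>y\<close> becomes the last variable, which the
          form over \<open>{1..n + 1}\<close> does not see.\<close>
        let ?x = "x(Suc (Suc n) := y)"
        have "\<forall>j\<in>{1..Suc n + 1}. ?x j \<in> R"
          using x y by (auto simp: le_Suc_eq)
        then have "alternating_form A {1..Suc n + 1} ?x = 0"
          using zero by blast
        then have "alternating_form (\<lambda>u. leibniz_defect A u y) {1..n + 1} ?x = 0"
          using form[of ?x] by simp
        then show ?thesis
          using symmetric_form_cong_var[of "{1..n + 1}" ?x x] by simp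
      qed
      then show ?thesis
        using Suc.IH[of "\<lambda>u. leibniz_defect A u y"] leibniz_defect_one[where f = A, OF Suc.prems(2)]
          additive_on_leibniz_defect[OF R Suc.prems(1) y] by simp
    qed
    have right: "(\<lambda>u. leibniz_defect A y u) \<in> derivations_of_order n R" if "y \<in> R" for y
      using left[OF that] by (simp add: leibniz_defect_commute[of A y])
    show "A \<in> derivations_of_order (Suc n) R"
      using left right Suc.prems leibniz_defect_in[OF R Suc.prems(1)]
      by (auto intro!: exI[of _ "leibniz_defect A"]) (simp add: leibniz_defect_def)
  qed
qed

section \<open>From arbitrary coefficients to derivations\<close>

lemma derivations_of_order_Suc:
  assumes "unital_subring R"
  shows "derivations_of_order n R \<subseteq> derivations_of_order (Suc n) R"
proof (induction n)
  case 0
  have "additive_on R f" if "\<forall>x\<in>R. f x = 0" for f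
    using that unital_subring_zero[OF assms] unital_subring_add[OF assms]
    by (simp add: additive_on_def Pi_iff)
  moreover have "x * y \<in> R" if "x \<in> R" "y \<in> R" for x y
    using assms that by (simp add: unital_subring_def)
  ultimately show ?case
    using unital_subring_zero[OF assms] by (auto intro!: exI[of _ "\<lambda>_ _. 0"])
next
  case (Suc n)
  show ?case
  proof
    fix f assume "f \<in> derivations_of_order (Suc n) R"
    then obtain B where "additive_on R f" "\<forall>x\<in>R. \<forall>y\<in>R. B x y \<in> R"
      "\<forall>y\<in>R. (\<lambda>x. B x y) \<in> derivations_of_order n R"
      "\<forall>x\<in>R. (\<lambda>y. B x y) \<in> derivations_of_order n R"
      "\<forall>x\<in>R. \<forall>y\<in>R. f (x * y) - x * f y - f x * y = B x y"
      by auto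
    then show "f \<in> derivations_of_order (Suc (Suc n)) R"
      \<comment> \<open>The same \<open>B\<close> serves; the induction hypothesis raises the order
        of its slices.\<close>
      unfolding derivations_of_order.simps(2)[of "Suc n"] mem_Collect_eq
      by (intro conjI exI[of _ B]) (use Suc.IH in \<open>simp_all only: subset_eq, blast+\<close>)
  qed
qed

lemma vanishing_symmetric_form_one:
  assumes "unital_subring R"
    and "\<forall>x. (\<forall>j\<in>{1..Suc n + 1}. x j \<in> R) \<longrightarrow> symmetric_form c A {1..Suc n + 1} x = 0"
    and "\<forall>j\<in>{1..n + 1}. x j \<in> R"
  shows "symmetric_form (\<lambda>i. c i + c (Suc i)) A {1..n + 1} x = 0"
proof -
  have "\<forall>j\<in>{1..Suc n + 1}. (x(Suc (Suc n) := 1)) j \<in> R"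
    using assms(1,3) by (auto simp: le_Suc_eq unital_subring_def)
  then have "symmetric_form c A {1..Suc n + 1} (x(Suc (Suc n) := 1)) = 0"
    using assms(2) by blast
  then show ?thesis
    using symmetric_form_insert_one[of "{1..n + 1}" "Suc (Suc n)" c A x]
    unfolding atLeastAtMost_Suc_insert by simp
qed

text \<open>The nonzero coefficient is sought up to index \<open>n\<close>, since the one at
  \<open>n + 1\<close> multiplies \<open>A 1 = 0\<close>. The induction varies \<open>c\<close>,
  because setting a variable to 1 replaces it by sums of neighbours.\<close>

lemma vanishing_symmetric_form_imp_derivation:
  fixes R :: "'a::idom set"
  assumes "unital_subring R" "additive_on R A" "A 1 = 0" "\<exists>i\<le>n. c i \<noteq> 0"
    and "\<forall>x. (\<forall>j\<in>{1..n + 1}. x j \<in> R) \<longrightarrow> symmetric_form c A {1..n + 1} x = 0"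
  shows "A \<in> derivations_of_order n R"
  using assms(4,5)
proof (induction n arbitrary: c)
  case 0
  have "c 0 * A u = 0" if "u \<in> R" for u
    using 0(2)[rule_format, of "\<lambda>_. u"] that
    by (simp add: symmetric_form_singleton[where A = A, OF assms(3)])
  then show ?case using 0(1) by simp
next
  case (Suc n)
  show ?case
  proof (cases "\<exists>i\<le>n. c i + c (Suc i) \<noteq> 0")
    case True
    then have "A \<in> derivations_of_order n R"
      using vanishing_symmetric_form_one[OF assms(1) Suc.prems(2)] by (intro Suc.IH) auto
    then show ?thesis
      using derivations_of_order_Suc[OF assms(1)] by blast
  next
    case False
    \<comment> \<open>The vanishing sums reach exactly index \<open>Suc n\<close>; the next
      coefficient is the free top one.\<close>
    have alt: "c i = c 0 * (- 1) ^ i" if "i \<le> Suc n" for i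
      using that
    proof (induction i)
      case (Suc i)
      then have "c i + c (Suc i) = 0" using False by auto
      then show ?case using Suc by (simp add: add_eq_0_iff)
    qed simp
    have "c 0 \<noteq> 0" using alt Suc.prems(1) by force
    moreover have "symmetric_form c A {1..Suc n + 1} x = c 0 * alternating_form A {1..Suc n + 1} x" for x
      unfolding symmetric_form_mult[symmetric]
      using assms(3) by (intro symmetric_form_cong alt) auto
    ultimately show ?thesis
      using Suc.prems(2) unfolding derivations_of_order_iff_alternating_form[OF assms(1-3)]
      by simp
  qed
qed

section \<open>Binomial weights and the linear relation\<close>

lemma sum_choose_Suc_shift:
  fixes c :: "nat \<Rightarrow> 'a::comm_semiring_1"
  shows "(\<Sum>i\<le>n. of_nat (n choose i) * (c i + c (Suc i))) = (\<Sum>i\<le>Suc n. of_nat (Suc n choose i) * c i)"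
proof -
  \<comment> \<open>Pascal's rule after splitting off \<open>c 0\<close>, which is then put back
    into the second sum, whose last binomial coefficient is 0.\<close>
  have "(\<Sum>i\<le>Suc n. of_nat (Suc n choose i) * c i) =
      c 0 + (\<Sum>i\<le>n. of_nat (n choose i) * c (Suc i)) + (\<Sum>i\<le>n. of_nat (n choose Suc i) * c (Suc i))"
    by (subst sum.atMost_Suc_shift) (simp add: sum.distrib algebra_simps)
  also have "c 0 + (\<Sum>i\<le>n. of_nat (n choose i) * c (Suc i)) + (\<Sum>i\<le>n. of_nat (n choose Suc i) * c (Suc i)) =
      (\<Sum>i\<le>n. of_nat (n choose i) * c (Suc i)) + (\<Sum>i\<le>Suc n. of_nat (n choose i) * c i)"
    by (subst sum.atMost_Suc_shift) (simp add: algebra_simps)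
  also have "(\<Sum>i\<le>Suc n. of_nat (n choose i) * c i) = (\<Sum>i\<le>n. of_nat (n choose i) * c i)"
    by (simp add: binomial_eq_0)
  finally show ?thesis
    by (simp add: sum.distrib algebra_simps)
qed

text \<open>Each substitution of 1 adds neighbouring coefficients, so \<open>n\<close> of them leave
  one variable with binomially weighted coefficient.\<close>

lemma vanishing_symmetric_form_sum_choose:
  assumes "unital_subring R" "A 1 = 0" "u \<in> R"
    and "\<forall>x. (\<forall>j\<in>{1..n + 1}. x j \<in> R) \<longrightarrow> symmetric_form c A {1..n + 1} x = 0"
  shows "(\<Sum>i\<le>n. of_nat (n choose i) * c i) * A u = 0"
  using assms(4)
proof (induction n arbitrary: c)
  case 0
  show ?case
    using 0[rule_format, of "\<lambda>_. u"] assms(3)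
    by (simp add: symmetric_form_singleton[where A = A, OF assms(2)])
next
  case (Suc n)
  have "(\<Sum>i\<le>n. of_nat (n choose i) * (c i + c (Suc i))) * A u = 0"
    using vanishing_symmetric_form_one[OF assms(1) Suc.prems] by (intro Suc.IH) blast
  then show ?case by (simp only: sum_choose_Suc_shift)
qed

text \<open>Group the subsets by cardinality. The form has one extra class, the full set, with
  coefficient \<open>a 0\<close>; its term vanishes by \<open>A 1 = 0\<close>.\<close>

lemma symmetrized_sum_eq_symmetric_form:
  assumes "A 1 = 0"
  shows "symmetrized_sum n a A x =
    symmetric_form (\<lambda>i. a (n + 1 - i) / of_nat ((n + 1) choose i)) A {1..n + 1} x"
proof -
  let ?S = "{1..n + 1}"
  let ?c = "\<lambda>i. a (n + 1 - i) / of_nat ((n + 1) choose i)"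
  let ?g = "\<lambda>I. prod x I * A (prod x (?S - I))"
  have top: "{I. I \<subseteq> ?S \<and> card I = Suc n} = {?S}"
    using card_subset_eq[of ?S] by auto
  have "symmetric_form ?c A ?S x = (\<Sum>i\<in>{0..Suc n}. \<Sum>I\<in>{I \<in> Pow ?S. card I = i}. ?c (card I) * ?g I)"
    unfolding symmetric_form_def
    by (rule sum.group[symmetric]) (auto dest: card_mono[rotated])
  also have "\<dots> = (\<Sum>i\<in>{0..Suc n}. ?c i * (\<Sum>I | I \<subseteq> ?S \<and> card I = i. ?g I))"
    by (intro sum.cong refl) (simp add: sum_distrib_left)
  also have "\<dots> = symmetrized_sum n a A x"
    unfolding symmetrized_sum_def using top assms by (simp add: sum.atLeast0_atMost_Suc)
  finally show ?thesis by simp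
qed

theorem theorem4:
  fixes R :: "'a::field_char_0 set" and A :: "'a \<Rightarrow> 'a" and n :: nat
  assumes "unital_subring R"
    and "additive_on R A"
    and "A 1 = 0"
  shows "(A \<in> derivations_of_order n R \<longleftrightarrow>
           (\<exists>a :: nat \<Rightarrow> 'a. (\<exists>i\<in>{1..n + 1}. a i \<noteq> 0) \<and>
              (\<forall>x. (\<forall>j\<in>{1..n + 1}. x j \<in> R) \<longrightarrow> symmetrized_sum n a A x = 0))) \<and>
         (\<forall>a :: nat \<Rightarrow> 'a.
            (\<exists>x\<in>R. A x \<noteq> 0) \<and>
            (\<forall>x. (\<forall>j\<in>{1..n + 1}. x j \<in> R) \<longrightarrow> symmetrized_sum n a A x = 0) \<longrightarrow>
            (\<Sum>i=1..n + 1. of_nat i * a i) = 0)"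
proof (intro conjI iffI allI impI)
  \<comment> \<open>Chosen so that dividing by the binomial coefficient at
    \<open>i = n + 1 - j\<close> leaves \<open>(- 1) ^ i\<close>; in particular the constant at
    \<open>n + 1\<close> is 1.\<close>
  let ?a = "\<lambda>j. (- 1) ^ (n + 1 - j) * of_nat ((n + 1) choose (n + 1 - j)) :: 'a"
  assume "A \<in> derivations_of_order n R"
  then have "\<forall>x. (\<forall>j\<in>{1..n + 1}. x j \<in> R) \<longrightarrow> alternating_form A {1..n + 1} x = 0"
    using derivations_of_order_iff_alternating_form[OF assms] by blast
  moreover have "symmetrized_sum n ?a A x = alternating_form A {1..n + 1} x" for x
    unfolding symmetrized_sum_eq_symmetric_form[where A = A, OF assms(3)]
    by (rule symmetric_form_cong) (use assms(3) in \<open>auto simp del: binomial_Suc_Suc\<close>)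
  moreover have "\<exists>i\<in>{1..n + 1}. ?a i \<noteq> 0"
    by (rule bexI[of _ "n + 1"]) auto
  ultimately show "\<exists>a :: nat \<Rightarrow> 'a. (\<exists>i\<in>{1..n + 1}. a i \<noteq> 0) \<and>
      (\<forall>x. (\<forall>j\<in>{1..n + 1}. x j \<in> R) \<longrightarrow> symmetrized_sum n a A x = 0)"
    by (intro exI[of _ ?a]) simp
next
  assume "\<exists>a :: nat \<Rightarrow> 'a. (\<exists>i\<in>{1..n + 1}. a i \<noteq> 0) \<and>
      (\<forall>x. (\<forall>j\<in>{1..n + 1}. x j \<in> R) \<longrightarrow> symmetrized_sum n a A x = 0)"
  then obtain a :: "nat \<Rightarrow> 'a" and k where k: "k \<in> {1..n + 1}" "a k \<noteq> 0"
    and a: "\<forall>x. (\<forall>j\<in>{1..n + 1}. x j \<in> R) \<longrightarrow> symmetrized_sum n a A x = 0"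
    by blast
  let ?c = "\<lambda>i. a (n + 1 - i) / of_nat ((n + 1) choose i)"
  \<comment> \<open>The constant \<open>a k\<close> sits at cardinality \<open>n + 1 - k\<close>,
    within range as \<open>k\<close> is positive; the binomial coefficient is nonzero in
    characteristic 0.\<close>
  have "n + 1 - k \<le> n" "a (n + 1 - (n + 1 - k)) / of_nat ((n + 1) choose (n + 1 - k)) \<noteq> 0"
    using k by (auto simp del: binomial_Suc_Suc)
  then show "A \<in> derivations_of_order n R"
    using a unfolding symmetrized_sum_eq_symmetric_form[where A = A, OF assms(3)]
    by (intro vanishing_symmetric_form_imp_derivation[OF assms, where c = ?c]) blast+
next
  fix a :: "nat \<Rightarrow> 'a"
  let ?c = "\<lambda>i. a (n + 1 - i) / of_nat ((n + 1) choose i)"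
  assume "(\<exists>x\<in>R. A x \<noteq> 0) \<and>
      (\<forall>x. (\<forall>j\<in>{1..n + 1}. x j \<in> R) \<longrightarrow> symmetrized_sum n a A x = 0)"
  \<comment> \<open>A nonzero value of \<open>A\<close> on \<open>R\<close> is cancelled.\<close>
  then have zero: "(\<Sum>i\<le>n. of_nat (n choose i) * ?c i) = 0"
    using vanishing_symmetric_form_sum_choose[where A = A and c = ?c, OF assms(1,3)]
    unfolding symmetrized_sum_eq_symmetric_form[where A = A, OF assms(3)] by auto
  \<comment> \<open>Absorption turns \<open>n + 1\<close> times the vanishing sum into the required
    one, read in reverse order.\<close>
  have summand: "of_nat (n + 1) * (of_nat (n choose i) * ?c i) = of_nat (n + 1 - i) * a (n + 1 - i)"
    if "i \<le> n" for i
  proof -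
    have "(n + 1 - i) * ((n + 1) choose i) = (n + 1) * (n choose i)"
      using binomial_absorb_comp[of "n + 1" i] by simp
    then have "of_nat (n + 1) * of_nat (n choose i) =
        (of_nat (n + 1 - i) * of_nat ((n + 1) choose i) :: 'a)"
      by (metis of_nat_mult)
    moreover have "of_nat ((n + 1) choose i) \<noteq> (0 :: 'a)"
      using that by (simp del: binomial_Suc_Suc)
    ultimately show ?thesis
      by (simp add: mult.assoc[symmetric] del: binomial_Suc_Suc of_nat_Suc)
  qed
  have "(\<Sum>i=1..n + 1. of_nat i * a i) = (\<Sum>i\<le>n. of_nat (n + 1 - i) * a (n + 1 - i))"
    by (rule sum.reindex_bij_witness[of _ "\<lambda>i. n + 1 - i" "\<lambda>i. n + 1 - i"]) auto
  also have "\<dots> = of_nat (n + 1) * (\<Sum>i\<le>n. of_nat (n choose i) * ?c i)"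
    unfolding sum_distrib_left by (rule sum.cong) (use summand in auto)
  finally show "(\<Sum>i=1..n + 1. of_nat i * a i) = 0"
    using zero by simp
qed

end
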